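(* Let $k>0$ be fixed. Then $$\mathrm{mes}\left(\mathcal S_\varrho\setminus V_0^{-1}\left([0,|\ln\varepsilon^k|]\right)\right)=O(\varepsilon^{k/n})\quad\text{as }\varepsilon\to+0 .$$
   Context: $n\in\mathbb N$; $|r|=\sum_{j=1}^n|r_j|$; $\mathrm{mes}$ is Lebesgue measure on $\mathbb R^n$. $\varrho$ is a fixed number with $\varrho>\max\{\sqrt n(\alpha^*+\delta)/A_*,1\}$, where $\alpha^*\ge0$, $A_*>0$, $\delta>0$ are given constants. $\mathcal S_\varrho=\{r\in[0,\infty)^n:|r|\le\varrho\}$. $V_0(r)=\sum_{i=1}^n(r_i-1-\ln r_i)$ for $r\in(0,\infty)^n$, and $V_0^{-1}([0,c])=\{r\in(0,\infty)^n:V_0(r)\le c\}$. *)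

theory Defs
  imports "HOL-Analysis.Analysis" "HOL-Library.Landau_Symbols"
begin

definition l1_norm :: "real ^ 'n::finite \<Rightarrow> real" where
  "l1_norm r = (\<Sum>j\<in>UNIV. \<bar>r $ j\<bar>)"

definition simplex_S :: "real \<Rightarrow> (real ^ 'n::finite) set" where
  "simplex_S \<rho> = {r. (\<forall>i. 0 \<le> r $ i) \<and> l1_norm r \<le> \<rho>}"

(* V0 is meant only on the open positive orthant; at non-positive coordinates
   the total function ln returns conventional values, so the sublevel set below
   restricts to positive coordinates explicitly. *)
definition V0 :: "real ^ 'n::finite \<Rightarrow> real" where
  "V0 r = (\<Sum>i\<in>UNIV. r $ i - 1 - ln (r $ i))"

definition V0_sublevel :: "real \<Rightarrow> (real ^ 'n::finite) set" where
  "V0_sublevel c = {r. (\<forall>i. 0 < r $ i) \<and> V0 r \<le> c}"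

(* The set difference is bounded and Borel, so the real-valued "measure lebesgue"
   of it is its genuine (finite) Lebesgue measure and not a default value. *)
lemma simplex_S_minus_V0_sublevel_lmeasurable:
  "(simplex_S \<rho> - V0_sublevel c :: (real ^ 'n::finite) set) \<in> lmeasurable"
proof -
  have S: "simplex_S \<rho> \<in> sets (borel :: (real ^ 'n) measure)"
    unfolding simplex_S_def l1_norm_def by measurable
  have V: "V0_sublevel c \<in> sets (borel :: (real ^ 'n) measure)"
    unfolding V0_sublevel_def V0_def by measurable
  have bdd: "bounded (simplex_S \<rho> :: (real ^ 'n) set)"
    unfolding bounded_iff simplex_S_def l1_norm_def
    by (intro exI[of _ \<rho>]) (auto intro: order_trans[OF norm_le_l1_cart])
  show ?thesis
    by (rule bounded_set_imp_lmeasurable[OF bounded_subset[OF bdd]])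
      (use S V in \<open>auto intro!: sets.Diff\<close>)
qed

end

(* If V0 r exceeds c, then by pigeonhole one of its n summands exceeds c / n, and since r $ i \<le> \<rho>
   this forces r $ i < exp (\<rho> - 1 - c / n).  So the exceptional part of the simplex is covered by n
   slabs of this thickness in the cube of side \<rho>.  For c = |ln (\<epsilon> powr k)| the thickness is
   at most exp (\<rho> - 1) * \<epsilon> powr (k / n). *)
theory Submission
  imports Defs
begin

lemma simplex_S_component_le:
  fixes r :: "real ^ 'n::finite"
  assumes "r \<in> simplex_S \<rho>"
  shows "r $ i \<le> \<rho>"
proof -
  have "r $ i \<le> \<bar>r $ i\<bar>"
    by simp
  also have "\<dots> \<le> (\<Sum>j\<in>UNIV. \<bar>r $ j\<bar>)"
    by (rule member_le_sum) auto
  also have "\<dots> \<le> \<rho>"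
    using assms unfolding simplex_S_def l1_norm_def by blast
  finally show ?thesis .
qed

lemma small_component_outside_V0_sublevel:
  fixes r :: "real ^ 'n::finite"
  assumes r: "r \<in> simplex_S \<rho> - V0_sublevel c"
  obtains i where "r $ i \<le> exp (\<rho> - 1 - c / real CARD('n))"
proof (cases "\<forall>i. 0 < r $ i")
  case True
  then have "V0 r > c"
    using r by (auto simp: V0_sublevel_def)
  have "\<exists>i. r $ i - 1 - ln (r $ i) > c / real CARD('n)"
  proof (rule ccontr)
    assume "\<not> ?thesis"
    then have "V0 r \<le> (\<Sum>i\<in>(UNIV :: 'n set). c / real CARD('n))"
      unfolding V0_def by (intro sum_mono) (auto simp: not_less)
    then show False
      using \<open>V0 r > c\<close> by simp
  qed
  then obtain i where "r $ i - 1 - ln (r $ i) > c / real CARD('n)" ..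
  moreover have "r $ i \<le> \<rho>"
    using r by (auto intro: simplex_S_component_le)
  ultimately have "ln (r $ i) \<le> \<rho> - 1 - c / real CARD('n)"
    by linarith
  then have "r $ i \<le> exp (\<rho> - 1 - c / real CARD('n))"
    using True by (metis exp_le_cancel_iff exp_ln)
  then show thesis ..
next
  case False
  then obtain i where "r $ i \<le> 0"
    by (auto simp: not_less)
  then show thesis
    by (intro that[of i]) (rule order_trans[OF _ exp_ge_zero])
qed

text \<open>Subadditivity over the covering slabs, whose overlaps are simply counted repeatedly.
  Keeping \<open>c\<close> arbitrary separates the geometry from \<epsilon>: \<open>c\<close> enters
  only through the exponential factor.\<close>

lemma measure_simplex_S_minus_V0_sublevel_le:
  assumes "\<rho> \<ge> 0"
  shows "measure lebesgue (simplex_S \<rho> - V0_sublevel c :: (real ^ 'n::finite) set)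
    \<le> real CARD('n) * \<rho> ^ (CARD('n) - 1) * exp (\<rho> - 1 - c / real CARD('n))"
proof -
  define t where "t = exp (\<rho> - 1 - c / real CARD('n))"
  \<comment> \<open>For small \<open>c\<close> the thickness \<open>t\<close> may exceed \<rho>. The
    box then sticks out of the cube, but the covering and the volume formula still hold.\<close>
  define B :: "'n \<Rightarrow> (real ^ 'n) set"
    where "B i = cbox 0 (\<chi> j. if j = i then t else \<rho>)" for i
  have "simplex_S \<rho> - V0_sublevel c \<subseteq> (\<Union>i. B i)"
  proof
    fix r :: "real ^ 'n"
    assume r: "r \<in> simplex_S \<rho> - V0_sublevel c"
    then obtain i where "r $ i \<le> t"
      unfolding t_def by (rule small_component_outside_V0_sublevel)
    with r have "r \<in> B i"
      by (auto simp: B_def mem_box_cart simplex_S_component_le)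
        (auto simp: simplex_S_def)
    then show "r \<in> (\<Union>i. B i)"
      by blast
  qed
  then have "measure lebesgue (simplex_S \<rho> - V0_sublevel c :: (real ^ 'n) set)
      \<le> measure lebesgue (\<Union>i. B i)"
    by (intro measure_mono_fmeasurable fmeasurableD[OF simplex_S_minus_V0_sublevel_lmeasurable]
        fmeasurable.finite_UN) (auto simp: B_def)
  also have "\<dots> \<le> (\<Sum>i\<in>UNIV. measure lebesgue (B i))"
    by (rule measure_UNION_le) (auto simp: B_def)
  also have "\<dots> = (\<Sum>i\<in>(UNIV :: 'n set). t * \<rho> ^ (CARD('n) - 1))"
  proof (rule sum.cong[OF refl])
    fix i :: 'n
    \<comment> \<open>The content of a box is the product of its side lengths only if the box is
      nonempty, hence the use of \<rho> \<ge> 0.\<close>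
    have "B i \<noteq> {}"
      using assms by (auto simp: B_def interval_ne_empty_cart t_def)
    then have "measure lebesgue (B i) = (\<Prod>j\<in>UNIV. if j = i then t else \<rho>)"
      by (simp add: B_def content_cbox_cart)
    also have "\<dots> = t * (\<Prod>j\<in>UNIV - {i}. if j = i then t else \<rho>)"
      by (subst prod.remove[of _ i]) auto
    also have "(\<Prod>j\<in>UNIV - {i}. if j = i then t else \<rho>) = (\<Prod>j\<in>UNIV - {i}. \<rho>)"
      by (rule prod.cong) auto
    finally show "measure lebesgue (B i) = t * \<rho> ^ (CARD('n) - 1)"
      by (simp add: card_Diff_singleton)
  qed
  finally show ?thesis
    by (simp add: t_def mult_ac)
qed

theorem corollary3:
  fixes k \<alpha> A \<delta> \<rho> :: real
  assumes "\<alpha> \<ge> 0" and "A > 0" and "\<delta> > 0"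
    and "\<rho> > max (sqrt (real CARD('n::finite)) * (\<alpha> + \<delta>) / A) 1"
    and "k > 0"
  shows "(\<lambda>\<epsilon>. measure lebesgue
            (simplex_S \<rho> - V0_sublevel \<bar>ln (\<epsilon> powr k)\<bar> :: (real ^ 'n) set))
          \<in> O[at_right 0](\<lambda>\<epsilon>. \<epsilon> powr (k / real CARD('n)))"
proof (rule bigoI)
  let ?n = "real CARD('n)"
  \<comment> \<open>What remains of the volume bound once the factor \<open>exp (- c / ?n)\<close>,
    the only one depending on \<epsilon>, is split off.\<close>
  let ?C = "?n * \<rho> ^ (CARD('n) - 1) * exp (\<rho> - 1)"
  have \<rho>: "\<rho> \<ge> 0"
    using assms(4) by simp
  have "measure lebesgue (simplex_S \<rho> - V0_sublevel \<bar>ln (\<epsilon> powr k)\<bar> :: (real ^ 'n) set)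
      \<le> ?C * \<epsilon> powr (k / ?n)" if "\<epsilon> > 0" for \<epsilon> :: real
  proof -
    \<comment> \<open>Since \<open>- \<bar>x\<bar> \<le> x\<close> for every real \<open>x\<close>,
      no restriction to \<epsilon> \<le> 1 is required; in that range equality holds.\<close>
    have "- (\<bar>ln (\<epsilon> powr k)\<bar> / ?n) \<le> ln (\<epsilon> powr k) / ?n"
      unfolding minus_divide_left by (rule divide_right_mono) auto
    also have "\<dots> = k / ?n * ln \<epsilon>"
      using that by (simp add: ln_powr)
    finally have "exp (\<rho> - 1 - \<bar>ln (\<epsilon> powr k)\<bar> / ?n) \<le> exp (\<rho> - 1 + k / ?n * ln \<epsilon>)"
      by simp
    also have "\<dots> = exp (\<rho> - 1) * \<epsilon> powr (k / ?n)"
      using that by (simp add: exp_add powr_def)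
    finally have "?n * \<rho> ^ (CARD('n) - 1) * exp (\<rho> - 1 - \<bar>ln (\<epsilon> powr k)\<bar> / ?n)
        \<le> ?n * \<rho> ^ (CARD('n) - 1) * (exp (\<rho> - 1) * \<epsilon> powr (k / ?n))"
      by (rule mult_left_mono) (use \<rho> in simp)
    with measure_simplex_S_minus_V0_sublevel_le[OF \<rho>, where 'n = 'n] show ?thesis
      unfolding mult.assoc by (rule order_trans)
  qed
  then show "\<forall>\<^sub>F \<epsilon> in at_right 0. norm (measure lebesgue
        (simplex_S \<rho> - V0_sublevel \<bar>ln (\<epsilon> powr k)\<bar> :: (real ^ 'n) set))
      \<le> ?C * norm (\<epsilon> powr (k / ?n))"
    by (auto intro: eventually_mono[OF eventually_at_right_less[of 0]])
qed

end
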